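(* Let $[a,b] \subset \mathbb{R}$ be a compact interval and let $f : [a,b] \to \mathbb{R}$ be Riemann-integrable. Suppose that $f$ has a limit everywhere on the open interval $(a,b)$, i.e. for every $x \in (a,b)$ the limit $\lim_{y \to x} f(y)$ exists. Then $f$ is continuous almost everywhere on $[a,b]$ with respect to Lebesgue measure.
   Context: The limit $\lim_{y \to x} f(y)$ is the usual two-sided limit at $x$, taken over $y \neq x$; the value $f(x)$ plays no role in its existence or value. Riemann integrability is the usual notion for bounded functions on a compact interval. *)

theory Defs
  imports "HOL-Analysis.Analysis"
begin

text \<open>
  The library's \<open>integrable_on\<close> is Henstock--Kurzweil integrability. Riemann integrability requires
  one mesh bound \<open>\<delta>\<close>, independent of the tag, for each \<open>\<epsilon>\<close>. On the real line \<open>tagged_division_of\<close>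
  yields the usual tagged partitions, possibly with additional degenerate intervals, which
  contribute 0 to the Riemann sum.
\<close>
definition riemann_integrable :: "(real \<Rightarrow> real) \<Rightarrow> real \<Rightarrow> real \<Rightarrow> bool" where
  "riemann_integrable f a b \<longleftrightarrow>
     bounded (f ` {a..b}) \<and>
     (\<exists>I. \<forall>\<epsilon>>0. \<exists>\<delta>>0. \<forall>p. p tagged_division_of {a..b} \<and> (\<forall>(x, K)\<in>p. diameter K < \<delta>) \<longrightarrow>
        \<bar>(\<Sum>(x, K)\<in>p. measure lborel K * f x) - I\<bar> < \<epsilon>)"

end

theory Submission
  imports Defs
begin

text \<open>
  Only countably many points of a second countable space carry a limit of \<open>f\<close> that differs from the
  value of \<open>f\<close>: if \<open>f x < r < lim f\<close> with \<open>r\<close> rational, then \<open>x\<close> is an isolated point of the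
  sublevel set \<open>{f \<le> r}\<close>, and a set has only countably many isolated points. The case
  \<open>lim f < f x\<close> is dual. So all discontinuities but the end points form a countable set.
\<close>

text \<open>An isolated point is cut out of \<open>A\<close> by some member of a countable basis.
  That member determines the point, so the isolated points inject into the basis.\<close>

lemma countable_isolated_points:
  fixes A :: "'a::second_countable_topology set"
  shows "countable {x. x isolated_in A}"
proof -
  obtain B :: "'a set set" where B: "countable B" "topological_basis B"
    using ex_countable_basis by auto
  have "\<exists>U\<in>B. U \<inter> A = {x}" if x: "x isolated_in A" for x
  proof -
    obtain T where T: "open T" "T \<inter> A = {x}"
      using x unfolding isolated_in_def by blast
    then obtain U where "U \<in> B" "x \<in> U" "U \<subseteq> T"
      using topological_basisE[OF B(2), of T x] by blast
    with T show ?thesis by blast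
  qed
  then obtain U where U: "U x \<in> B" "U x \<inter> A = {x}" if "x isolated_in A" for x
    by metis
  have "inj_on U {x. x isolated_in A}"
  proof (rule inj_onI, unfold mem_Collect_eq)
    fix x y
    assume x: "x isolated_in A" and y: "y isolated_in A" and eq: "U x = U y"
    \<comment> \<open>Both singletons are the trace on \<open>A\<close> of the same basic
      set.\<close>
    have "{x} = {y}"
      using U(2)[OF x] U(2)[OF y] unfolding eq by (rule subst)
    then show "x = y" by (rule singleton_inject)
  qed
  moreover have "U ` {x. x isolated_in A} \<subseteq> B"
    using U(1) by blast
  then have "countable (U ` {x. x isolated_in A})"
    using B(1) by (rule countable_subset)
  ultimately show ?thesis
    by (metis countable_image_inj_on)
qed

lemma countable_limit_greater_value:
  fixes f :: "'a::second_countable_topology \<Rightarrow> real"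
  shows "countable {x\<in>S. \<exists>L. (f \<longlongrightarrow> L) (at x within S) \<and> f x < L}"
proof (rule countable_subset)
  show "{x\<in>S. \<exists>L. (f \<longlongrightarrow> L) (at x within S) \<and> f x < L}
          \<subseteq> (\<Union>r\<in>\<rat>. {x. x isolated_in {y\<in>S. f y \<le> r}})"
  proof clarify
    fix x L
    assume x: "x \<in> S" and lim: "(f \<longlongrightarrow> L) (at x within S)" and "f x < L"
    then obtain r where r: "r \<in> \<rat>" "f x < r" "r < L"
      using Rats_dense_in_real by blast
    have "\<forall>\<^sub>F y in at x within S. r < f y"
      using order_tendstoD(1)[OF lim r(3)] .
    then obtain T where T: "open T" "x \<in> T" "\<And>y. y \<in> T \<Longrightarrow> y \<noteq> x \<Longrightarrow> y \<in> S \<Longrightarrow> r < f y"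
      unfolding eventually_at_topological by blast
    \<comment> \<open>The punctured limit keeps every other point of \<open>T\<close> in
      \<open>S\<close> out of the sublevel set, while \<open>f x < r\<close> puts \<open>x\<close>
      itself in.\<close>
    have "T \<inter> {y\<in>S. f y \<le> r} = {x}"
      using T x r by force
    then have "x isolated_in {y\<in>S. f y \<le> r}"
      using T(1) x r(2) by (intro isolated_inI) auto
    with r(1) show "x \<in> (\<Union>r\<in>\<rat>. {x. x isolated_in {y\<in>S. f y \<le> r}})"
      by blast
  qed
  show "countable (\<Union>r\<in>\<rat>. {x. x isolated_in {y\<in>S. f y \<le> r}})"
    by (rule countable_UN[OF countable_rat countable_isolated_points])
qed

lemma countable_limit_neq_value:
  fixes f :: "'a::second_countable_topology \<Rightarrow> real"
  shows "countable {x\<in>S. \<exists>L. (f \<longlongrightarrow> L) (at x within S) \<and> L \<noteq> f x}" (is "countable ?N")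
proof (rule countable_subset)
  \<comment> \<open>The second set is the first one for \<open>- f\<close>: a limit
    \<open>L < f x\<close> of \<open>f\<close> becomes the limit \<open>- L > - f x\<close>.\<close>
  show "?N \<subseteq> {x\<in>S. \<exists>L. (f \<longlongrightarrow> L) (at x within S) \<and> f x < L}
            \<union> {x\<in>S. \<exists>L. ((\<lambda>y. - f y) \<longlongrightarrow> L) (at x within S) \<and> - f x < L}"
  proof
    fix x
    assume "x \<in> ?N"
    then obtain L where x: "x \<in> S" and L: "(f \<longlongrightarrow> L) (at x within S)" "L \<noteq> f x"
      by blast
    have neg: "((\<lambda>y. - f y) \<longlongrightarrow> - L) (at x within S)"
      using L(1) by (rule tendsto_minus)
    from L(2) consider "f x < L" | "- f x < - L"
      by linarith
    then show "x \<in> {x\<in>S. \<exists>L. (f \<longlongrightarrow> L) (at x within S) \<and> f x < L}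
            \<union> {x\<in>S. \<exists>L. ((\<lambda>y. - f y) \<longlongrightarrow> L) (at x within S) \<and> - f x < L}"
      using x L(1) neg by cases blast+
  qed
qed (intro countable_Un countable_limit_greater_value)

theorem mainTheorem1:
  fixes f :: "real \<Rightarrow> real" and a b :: real
  assumes "a \<le> b"
    and "riemann_integrable f a b"
    and "\<forall>x\<in>{a<..<b}. \<exists>L. (f \<longlongrightarrow> L) (at x within {a..b})"
  shows "AE x in lebesgue_on {a..b}. continuous (at x within {a..b}) f"
proof -
  \<comment> \<open>Limits are assumed only inside the open interval, so \<open>a\<close> and
    \<open>b\<close> are put into the exceptional set by hand.\<close>
  let ?N = "{x\<in>{a..b}. \<exists>L. (f \<longlongrightarrow> L) (at x within {a..b}) \<and> L \<noteq> f x} \<union> {a, b}"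
  have "countable ?N"
    by (intro countable_Un countable_limit_neq_value) simp
  \<comment> \<open>Countable sets are null for \<open>lborel\<close>, and the statement passes to
    its completion \<open>lebesgue\<close>.\<close>
  then have "AE x in lebesgue. x \<notin> ?N"
    by (intro AE_completion AE_not_in countable_imp_null_set_lborel)
  then have "AE x in lebesgue. x \<in> {a..b} \<longrightarrow> continuous (at x within {a..b}) f"
  proof eventually_elim
    case (elim x)
    show ?case
    proof
      assume x: "x \<in> {a..b}"
      with elim have "x \<in> {a<..<b}" by auto
      with assms(3) obtain L where L: "(f \<longlongrightarrow> L) (at x within {a..b})" by blast
      with elim x have "L = f x" by blast
      with L show "continuous (at x within {a..b}) f"
        by (simp add: continuous_within)
    qed
  qed
  then show ?thesis
    by (simp add: AE_restrict_space_iff)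
qed

end
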